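(* Let $A$ and $E$ be real symmetric $n\times n$ matrices with $E\ne0$, $\tilde A=A+E$, let $D\subset\mathbb R$ be a region with $\delta_D>0$, and let $K>0$ satisfy $$\delta_D\ \ge\ 6\max\left\{\sqrt{r_K\,x\,\|E\|},\ \frac{\|E\|}{K}\right\}.$$ Assume moreover that $D\subset[\lambda_n-\|E\|,\lambda_1+\|E\|]$, that no endpoint of $D$ is an eigenvalue of $\tilde A$, and that $$K\|E\|\le2\sigma_1+\delta_D,\qquad \delta_D\le\max\{\|E\|,\sigma_1\},\qquad K\ge5\,C_D\log\!\left(9+\frac{5\sigma_1}{\min\{\delta_D,\|E\|\}}\right)>10 .$$ Let $\Gamma\subset\mathbb C$ be the union, over the connected components $(x_0,x_1)$ of $D$, of the boundaries of the rectangles with vertices $x_0\pm\mathbf iH$, $x_1\pm\mathbf iH$, where $H=2(\sigma_1+\|E\|+\delta_D)$. Then for all $z\in\Gamma$, $$\|E(z-A)^{-1}E(z-A)^{-1}\|\ \le\ h:=\frac{r_K\,x\,\|E\|}{\delta_D^2}+\frac{2\|E\|}{\delta_DK}+\frac1{K^2}\ <\ \frac12 .$$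
   Context: $\|\cdot\|$ is the spectral norm; $\log$ is natural; $\mathbf i=\sqrt{-1}$; $z-A$ means $zI-A$. $A$ has eigenvalues $\lambda_1\ge\dots\ge\lambda_n$ (with multiplicity) and a fixed orthonormal eigenbasis $u_1,\dots,u_n$ (any choice is allowed when eigenvalues are multiple); $\sigma_1=\|A\|$. Directional perturbation: $x:=\max_{1\le i,j\le n}|u_i^\top E u_j|$. A region is the union of a finite number of disjoint open intervals of the real line. $C_D$ is the number of connected components of $D$, $\partial D$ its boundary, and $\delta_D:=\min_{1\le i\le n}\operatorname{dist}(\lambda_i,\partial D)$. For $K>0$, $r_K$ is the number of eigenvalues of $A$, counted with multiplicity, whose distance from $D$ is at most $K\|E\|$. *)

theory Defs
  imports "HOL-Analysis.Analysis"
begin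

definition spectral_norm :: "'a::real_normed_field^'n^'m \<Rightarrow> real"
  where "spectral_norm M = onorm ((*v) M)"

definition symmetric_matrix :: "real^'n^'n \<Rightarrow> bool"
  where "symmetric_matrix M \<longleftrightarrow> transpose M = M"

definition is_eigenvalue :: "real^'n^'n \<Rightarrow> real \<Rightarrow> bool"
  where "is_eigenvalue M c \<longleftrightarrow> (\<exists>v. v \<noteq> 0 \<and> M *v v = c *s v)"

(* Indices run over {1..n} with n = CARD('n).  As the u i form an orthonormal basis, the list
   lam 1, ..., lam n contains every eigenvalue of M as often as its multiplicity. *)
definition ordered_eigensystem ::
    "real^'n^'n \<Rightarrow> (nat \<Rightarrow> real) \<Rightarrow> (nat \<Rightarrow> real^'n) \<Rightarrow> bool"
  where "ordered_eigensystem M lam u \<longleftrightarrow>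
    (\<forall>i\<in>{1..CARD('n)}. \<forall>j\<in>{1..CARD('n)}. i \<le> j \<longrightarrow> lam j \<le> lam i) \<and>
    (\<forall>i\<in>{1..CARD('n)}. \<forall>j\<in>{1..CARD('n)}. u i \<bullet> u j = (if i = j then 1 else 0)) \<and>
    (\<forall>i\<in>{1..CARD('n)}. M *v u i = lam i *s u i)"

definition directional_perturbation :: "(nat \<Rightarrow> real^'n) \<Rightarrow> real^'n^'n \<Rightarrow> real"
  where "directional_perturbation u E =
    Max ((\<lambda>(i, j). \<bar>u i \<bullet> (E *v u j)\<bar>) ` ({1..CARD('n)} \<times> {1..CARD('n)}))"

definition region :: "real set \<Rightarrow> bool"
  where "region D \<longleftrightarrow>
    (\<exists>\<I>. finite \<I> \<and> pairwise disjnt \<I> \<and> (\<forall>I\<in>\<I>. open I \<and> is_interval I) \<and> D = \<Union>\<I>)"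

definition num_components :: "real set \<Rightarrow> nat"
  where "num_components D = card (components D)"

(* infdist to the empty set is 0, so a region without boundary has boundary_gap 0. *)
definition boundary_gap :: "nat \<Rightarrow> (nat \<Rightarrow> real) \<Rightarrow> real set \<Rightarrow> real"
  where "boundary_gap n lam D = Min ((\<lambda>i. infdist (lam i) (frontier D)) ` {1..n})"

definition num_eigenvalues_within :: "nat \<Rightarrow> (nat \<Rightarrow> real) \<Rightarrow> real set \<Rightarrow> real \<Rightarrow> nat"
  where "num_eigenvalues_within n lam D t = card {i \<in> {1..n}. infdist (lam i) D \<le> t}"

definition interval_components :: "real set \<Rightarrow> (real \<times> real) set"
  where "interval_components D = {(x0, x1). x0 < x1 \<and> {x0<..<x1} \<in> components D}"

definition endpoints :: "real set \<Rightarrow> real set"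
  where "endpoints D = (\<Union>(x0, x1)\<in>interval_components D. {x0, x1})"

(* For complex numbers, cbox a b is the closed rectangle with lower left corner a and
   upper right corner b. *)
definition rectangle_contour :: "real set \<Rightarrow> real \<Rightarrow> complex set"
  where "rectangle_contour D H =
    (\<Union>(x0, x1)\<in>interval_components D. frontier (cbox (Complex x0 (- H)) (Complex x1 H)))"

abbreviation complex_matrix :: "real^'n^'n \<Rightarrow> complex^'n^'n"
  where "complex_matrix M \<equiv> map_matrix complex_of_real M"

(* The inverse of z I - M.  As with every use of matrix_inv, the value is
   meaningful only where z I - M is invertible. *)
definition resolvent :: "complex \<Rightarrow> real^'n^'n \<Rightarrow> complex^'n^'n"
  where "resolvent z M = matrix_inv (mat z - complex_matrix M)"

end

theory Submission
  imports Defs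
begin

text \<open>Split the resolvent \<open>R\<close> of \<open>A\<close> at \<open>z\<close> into its part \<open>P\<close> on the eigenvectors whose eigenvalues are
  within \<open>K \<parallel>E\<parallel>\<close> of \<open>D\<close> and the remaining part \<open>Q\<close>. On the contour \<open>\<parallel>P\<parallel> \<le> 1 / \<delta>\<close> and
  \<open>\<parallel>Q\<parallel> \<le> 1 / (K \<parallel>E\<parallel>)\<close>, which bounds three of the four terms of \<open>E R E R\<close>. In \<open>E P E P\<close>, the
  operator \<open>P E P\<close> acts on \<open>r\<close> eigenvectors with matrix entries at most \<open>x / \<delta>\<^sup>2\<close>, so that
  \<open>\<parallel>P E P\<parallel> \<le> r x / \<delta>\<^sup>2\<close>.\<close>

section \<open>Complexified real vectors and their coordinates\<close>

definition cvec :: "real^'n \<Rightarrow> complex^'n"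
  where "cvec a = (\<chi> k. complex_of_real (a $ k))"

definition coord :: "real^'n \<Rightarrow> complex^'n \<Rightarrow> complex"
  where "coord a v = (\<Sum>k\<in>UNIV. complex_of_real (a $ k) * v $ k)"

lemma coord_add: "coord a (v + w) = coord a v + coord a w"
  by (simp add: coord_def distrib_left sum.distrib)

lemma coord_smult: "coord a (c *s v) = c * coord a v"
  by (simp add: coord_def sum_distrib_left algebra_simps)

lemma coord_diff: "coord a (v - w) = coord a v - coord a w"
  by (simp add: coord_def right_diff_distrib sum_subtractf)

lemma coord_zero: "coord a 0 = 0"
  by (simp add: coord_def)

lemma coord_sum: "coord a (\<Sum>i\<in>S. f i) = (\<Sum>i\<in>S. coord a (f i))"
  by (induction S rule: infinite_finite_induct) (simp_all add: coord_zero coord_add)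

lemma coord_cvec: "coord a (cvec b) = complex_of_real (a \<bullet> b)"
  by (simp add: coord_def cvec_def inner_vec_def)

lemma complex_matrix_cvec: "complex_matrix M *v cvec a = cvec (M *v a)"
  by (simp add: vec_eq_iff matrix_vector_mult_def cvec_def)

lemma cvec_smult: "cvec (c *s a) = complex_of_real c *s cvec a"
  by (simp add: vec_eq_iff cvec_def)

lemma matrix_vector_mult_sum:
  fixes M :: "complex^'n^'m"
  shows "M *v (\<Sum>i\<in>S. c i *s f i) = (\<Sum>i\<in>S. c i *s (M *v f i))"
  by (simp add: linear_sum[OF matrix_vector_mul_linear] vector_scalar_commute)

lemma mat_vector_mult: "mat c *v v = c *s v" for v :: "complex^'n"
  by (simp add: vec_eq_iff matrix_vector_mult_def mat_def if_distrib[where f = "\<lambda>x. x * _"] cong: if_cong)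

definition re_vec :: "complex^'n \<Rightarrow> real^'n" where "re_vec v = (\<chi> k. Re (v $ k))"

definition im_vec :: "complex^'n \<Rightarrow> real^'n" where "im_vec v = (\<chi> k. Im (v $ k))"

lemma norm_re_im_vec: "(norm v)\<^sup>2 = (norm (re_vec v))\<^sup>2 + (norm (im_vec v))\<^sup>2"
  by (simp add: power2_norm_eq_inner inner_vec_def re_vec_def im_vec_def sum.distrib
      inner_complex_def)

lemma coord_re_im: "coord a v = Complex (a \<bullet> re_vec v) (a \<bullet> im_vec v)"
  by (simp add: coord_def complex_eq_iff inner_vec_def re_vec_def im_vec_def)

lemma re_vec_mult: "re_vec (complex_matrix M *v v) = M *v re_vec v"
  by (simp add: vec_eq_iff matrix_vector_mult_def re_vec_def)

lemma im_vec_mult: "im_vec (complex_matrix M *v v) = M *v im_vec v"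
  by (simp add: vec_eq_iff matrix_vector_mult_def im_vec_def)

section \<open>The spectral norm and complexification\<close>

lemma norm_mult_le_spectral_norm: "norm (M *v a) \<le> spectral_norm M * norm a" for M :: "real^'n^'m"
  unfolding spectral_norm_def by (rule onorm) simp

lemma spectral_norm_nonneg: "0 \<le> spectral_norm M" for M :: "real^'n^'m"
  unfolding spectral_norm_def by (rule onorm_pos_le) simp

lemma spectral_norm_pos:
  fixes M :: "real^'n^'m"
  assumes "M \<noteq> 0"
  shows "0 < spectral_norm M"
proof -
  from assms obtain a where "M *v a \<noteq> 0"
    by (metis matrix_eq matrix_vector_mult_0)
  then show ?thesis
    unfolding spectral_norm_def by (subst onorm_pos_lt) auto
qed

text \<open>A real matrix acts separately on the real and imaginary parts, whose squared norms add
  up, so passing to complex vectors does not increase the operator norm.\<close>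

lemma norm_complex_matrix_mult_le:
  "norm (complex_matrix M *v v) \<le> spectral_norm M * norm v"
proof (rule power2_le_imp_le)
  have "(norm (complex_matrix M *v v))\<^sup>2 = (norm (M *v re_vec v))\<^sup>2 + (norm (M *v im_vec v))\<^sup>2"
    by (simp add: norm_re_im_vec re_vec_mult im_vec_mult)
  also have "\<dots> \<le> (spectral_norm M * norm (re_vec v))\<^sup>2 + (spectral_norm M * norm (im_vec v))\<^sup>2"
    by (intro add_mono power_mono norm_mult_le_spectral_norm) auto
  also have "\<dots> = (spectral_norm M * norm v)\<^sup>2"
    by (simp add: power_mult_distrib norm_re_im_vec[of v] distrib_left)
  finally show "(norm (complex_matrix M *v v))\<^sup>2 \<le> (spectral_norm M * norm v)\<^sup>2" .
qed (simp add: spectral_norm_nonneg)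

section \<open>Orthonormal expansions, operators diagonal in the basis, and the resolvent as one of
  them\<close>

locale orthonormal_family =
  fixes u :: "nat \<Rightarrow> real^'n"
  assumes orthonormal: "\<And>i j. i \<in> {1..CARD('n)} \<Longrightarrow> j \<in> {1..CARD('n)} \<Longrightarrow>
    u i \<bullet> u j = (if i = j then 1 else 0)"
begin

text \<open>Parseval's identity: \<open>CARD('n)\<close> orthonormal vectors are independent, hence
  span the whole space by dimension.\<close>

lemma norm_expansion: "(norm a)\<^sup>2 = (\<Sum>i\<in>{1..CARD('n)}. (u i \<bullet> a)\<^sup>2)"
proof -
  let ?I = "{1..CARD('n)}"
  have inj: "inj_on u ?I"
    by (rule inj_onI) (metis orthonormal zero_neq_one)
  have norm1: "norm b = 1" if "b \<in> u ` ?I" for b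
    using that orthonormal by (auto simp: norm_eq_sqrt_inner)
  have orth: "pairwise orthogonal (u ` ?I)"
    unfolding pairwise_def orthogonal_def using orthonormal by auto
  have "independent (u ` ?I)"
    using orth norm1 by (intro pairwise_orthogonal_independent) force+
  then have "UNIV \<subseteq> span (u ` ?I)"
    by (intro card_ge_dim_independent) (simp_all add: card_image[OF inj, simplified])
  then have "(\<Sum>b\<in>u ` ?I. (a \<bullet> b) *\<^sub>R b) = a"
    by (intro orthonormal_basis_expand orth norm1) auto
  then have "a = (\<Sum>i\<in>?I. (a \<bullet> u i) *\<^sub>R u i)"
    by (simp add: sum.reindex[OF inj, simplified])
  then have "a \<bullet> a = (\<Sum>i\<in>?I. (a \<bullet> u i) *\<^sub>R u i) \<bullet> a"
    by simp
  then show ?thesis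
    unfolding power2_norm_eq_inner inner_sum_left by (simp add: power2_eq_square inner_commute)
qed

lemma complex_norm_expansion: "(norm v)\<^sup>2 = (\<Sum>i\<in>{1..CARD('n)}. (cmod (coord (u i) v))\<^sup>2)"
  by (simp add: norm_re_im_vec norm_expansion coord_re_im cmod_power2 sum.distrib)

lemma complex_vector_eqI:
  assumes "\<And>i. i \<in> {1..CARD('n)} \<Longrightarrow> coord (u i) v = coord (u i) w"
  shows "v = w"
proof -
  have "(norm (v - w))\<^sup>2 = 0"
    using assms by (simp add: complex_norm_expansion coord_diff)
  then show ?thesis by simp
qed

text \<open>The operator that is diagonal in the basis \<open>u\<close> with entries
  \<open>g i\<close>. The resolvent and its near and far parts all have this form.\<close>

definition multiplier :: "(nat \<Rightarrow> complex) \<Rightarrow> complex^'n \<Rightarrow> complex^'n"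
  where "multiplier g v = (\<Sum>i\<in>{1..CARD('n)}. (g i * coord (u i) v) *s cvec (u i))"

lemma coord_multiplier:
  assumes "j \<in> {1..CARD('n)}"
  shows "coord (u j) (multiplier g v) = g j * coord (u j) v"
proof -
  have "coord (u j) (multiplier g v)
      = (\<Sum>i\<in>{1..CARD('n)}. if i = j then g i * coord (u i) v else 0)"
    unfolding multiplier_def coord_sum coord_smult coord_cvec
    using assms by (intro sum.cong) (auto simp: orthonormal)
  then show ?thesis using assms by simp
qed

lemma norm_multiplier_le:
  assumes "\<And>i. i \<in> {1..CARD('n)} \<Longrightarrow> cmod (g i) \<le> b" and "0 \<le> b"
  shows "norm (multiplier g v) \<le> b * norm v"
proof (rule power2_le_imp_le)
  have "(norm (multiplier g v))\<^sup>2 = (\<Sum>i\<in>{1..CARD('n)}. (cmod (g i) * cmod (coord (u i) v))\<^sup>2)"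
    by (simp add: complex_norm_expansion coord_multiplier norm_mult)
  also have "\<dots> \<le> (\<Sum>i\<in>{1..CARD('n)}. (b * cmod (coord (u i) v))\<^sup>2)"
    using assms by (intro sum_mono power_mono mult_right_mono) auto
  also have "\<dots> = (b * norm v)\<^sup>2"
    by (simp add: complex_norm_expansion power_mult_distrib sum_distrib_left)
  finally show "(norm (multiplier g v))\<^sup>2 \<le> (b * norm v)\<^sup>2" .
qed (use assms in auto)

lemma multiplier_add: "multiplier g (v + w) = multiplier g v + multiplier g w"
  by (rule complex_vector_eqI) (simp add: coord_multiplier coord_add distrib_left)

text \<open>Compressed to the span of the \<open>u i\<close> with \<open>i\<close> in
  \<open>S\<close>, the matrix has entries at most \<open>x\<close>, so its norm is at most the
  Frobenius bound \<open>card S * x\<close>. Each of the two multipliers contributes a factor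
  \<open>b\<close>.\<close>

lemma norm_multiplier_block_le:
  assumes S: "S \<subseteq> {1..CARD('n)}"
    and g: "\<And>i. i \<in> S \<Longrightarrow> cmod (g i) \<le> b" "\<And>i. i \<notin> S \<Longrightarrow> g i = 0" and b: "0 \<le> b"
    and x: "\<And>i j. i \<in> S \<Longrightarrow> j \<in> S \<Longrightarrow> \<bar>u i \<bullet> (M *v u j)\<bar> \<le> x" and x0: "0 \<le> x"
  shows "norm (multiplier g (complex_matrix M *v multiplier g v)) \<le> real (card S) * x * b\<^sup>2 * norm v"
proof (rule power2_le_imp_le)
  let ?I = "{1..CARD('n)}" and ?w = "complex_matrix M *v multiplier g v"
  let ?c = "\<lambda>j. cmod (coord (u j) v)"
  have fin: "finite S" using S finite_subset by blast
  have mono: "(\<Sum>j\<in>S. (?c j)\<^sup>2) \<le> (norm v)\<^sup>2"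
    unfolding complex_norm_expansion using S by (intro sum_mono2) auto
  have entry: "(cmod (coord (u i) ?w))\<^sup>2 \<le> (b * x)\<^sup>2 * (real (card S) * (norm v)\<^sup>2)" if i: "i \<in> S" for i
  proof -
    have "coord (u i) ?w
        = (\<Sum>j\<in>?I. (g j * coord (u j) v) * complex_of_real (u i \<bullet> (M *v u j)))"
      by (simp add: multiplier_def matrix_vector_mult_sum complex_matrix_cvec coord_sum
          coord_smult coord_cvec)
    also have "\<dots> = (\<Sum>j\<in>S. (g j * coord (u j) v) * complex_of_real (u i \<bullet> (M *v u j)))"
      using S g(2) by (intro sum.mono_neutral_right) auto
    finally have "cmod (coord (u i) ?w) \<le> (\<Sum>j\<in>S. (b * ?c j) * x)"
      by (simp only:) (rule sum_norm_le, use g(1) x[OF i] b in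
        \<open>auto simp: norm_mult intro!: mult_mono\<close>)
    also have "\<dots> = b * x * (\<Sum>j\<in>S. ?c j)"
      by (simp add: sum_distrib_left algebra_simps)
    finally have "(cmod (coord (u i) ?w))\<^sup>2 \<le> (b * x)\<^sup>2 * (\<Sum>j\<in>S. ?c j)\<^sup>2"
      by (metis norm_ge_zero power_mono power_mult_distrib)
    \<comment> \<open>Cauchy-Schwarz against the all-ones vector on \<open>S\<close>. This gives one
      factor \<open>card S\<close> in the squared norm; the sum over the rows \<open>i\<close> gives
      the second.\<close>
    also have "(\<Sum>j\<in>S. ?c j)\<^sup>2 \<le> real (card S) * (\<Sum>j\<in>S. (?c j)\<^sup>2)"
      using sum_squared_le_sum_of_squares[of ?c S] fin by (simp add: mult.commute)
    also have "\<dots> \<le> real (card S) * (norm v)\<^sup>2"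
      using mono by (intro mult_left_mono) auto
    finally show ?thesis by (simp add: mult_left_mono)
  qed
  have "(norm (multiplier g ?w))\<^sup>2 = (\<Sum>i\<in>?I. (cmod (g i))\<^sup>2 * (cmod (coord (u i) ?w))\<^sup>2)"
    by (simp add: complex_norm_expansion[of "multiplier g ?w"] coord_multiplier norm_mult power_mult_distrib)
  also have "\<dots> = (\<Sum>i\<in>S. (cmod (g i))\<^sup>2 * (cmod (coord (u i) ?w))\<^sup>2)"
    using S g(2) by (intro sum.mono_neutral_right) auto
  also have "\<dots> \<le> (\<Sum>i\<in>S. b\<^sup>2 * ((b * x)\<^sup>2 * (real (card S) * (norm v)\<^sup>2)))"
    using g(1) entry by (intro sum_mono mult_mono power_mono) auto
  also have "\<dots> = (real (card S) * x * b\<^sup>2 * norm v)\<^sup>2"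
    by (simp add: power2_eq_square algebra_simps)
  finally show "(norm (multiplier g ?w))\<^sup>2 \<le> (real (card S) * x * b\<^sup>2 * norm v)\<^sup>2" .
qed (use b x0 in auto)

text \<open>The multiplier with entries \<open>1 / (z - lam i)\<close> is checked to be a right
  inverse of \<open>z - A\<close>. For a square matrix this yields a two-sided inverse, so the value
  chosen by \<open>matrix_inv\<close> is a genuine inverse.\<close>

lemma resolvent_eq_multiplier:
  assumes eig: "\<And>i. i \<in> {1..CARD('n)} \<Longrightarrow> A *v u i = lam i *s u i"
    and z: "\<And>i. i \<in> {1..CARD('n)} \<Longrightarrow> z \<noteq> complex_of_real (lam i)"
  shows "resolvent z A *v v = multiplier (\<lambda>i. 1 / (z - complex_of_real (lam i))) v"
proof -
  let ?M = "mat z - complex_matrix A" and ?g = "\<lambda>i. 1 / (z - complex_of_real (lam i))"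
  have M: "?M *v multiplier ?g w = w" for w
  proof -
    have "complex_matrix A *v multiplier ?g w = multiplier (\<lambda>i. complex_of_real (lam i) * ?g i) w"
      unfolding multiplier_def matrix_vector_mult_sum complex_matrix_cvec
      by (intro sum.cong) (simp_all add: eig cvec_smult algebra_simps)
    moreover have "z * (?g i * c) - complex_of_real (lam i) * ?g i * c = c" if "i \<in> {1..CARD('n)}" for i c
    proof -
      have "z * (?g i * c) - complex_of_real (lam i) * ?g i * c
          = (z - complex_of_real (lam i)) / (z - complex_of_real (lam i)) * c"
        by (simp add: left_diff_distrib diff_divide_distrib del: divide_self_if)
      then show ?thesis using z[OF that] by (simp only: divide_self_if) simp
    qed
    ultimately show ?thesis
      by (intro complex_vector_eqI)
        (simp only: matrix_vector_mult_diff_rdistrib mat_vector_mult coord_diff coord_smult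
          coord_multiplier)
  qed
  then have "surj ((*v) ?M)" by (metis surjI)
  then obtain B where "?M ** B = mat 1"
    using matrix_right_invertible_surjective by blast
  then have "\<exists>B. ?M ** B = mat 1 \<and> B ** ?M = mat 1"
    by (metis matrix_left_right_inverse)
  then have "resolvent z A ** ?M = mat 1"
    unfolding resolvent_def matrix_inv_def by (rule someI2_ex) simp
  \<comment> \<open>Cancelling \<open>?M\<close> on the left identifies the resolvent with the
    multiplier, since \<open>?M\<close> undoes the multiplier.\<close>
  then have "resolvent z A *v (?M *v multiplier ?g v) = multiplier ?g v"
    by (simp add: matrix_vector_mul_assoc)
  then show ?thesis by (simp add: M)
qed

text \<open>Here \<open>d\<close> bounds from below the distance of \<open>z\<close> to every
  eigenvalue and \<open>s\<close> the distance to those outside \<open>S\<close>. The three summands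
  come from the near-near term, the two mixed terms and the far-far term.\<close>

lemma spectral_norm_resolvent_product_le:
  assumes eig: "\<And>i. i \<in> {1..CARD('n)} \<Longrightarrow> A *v u i = lam i *s u i"
    and S: "S \<subseteq> {1..CARD('n)}"
    and x: "\<And>i j. i \<in> S \<Longrightarrow> j \<in> S \<Longrightarrow> \<bar>u i \<bullet> (E *v u j)\<bar> \<le> x" and x0: "0 \<le> x"
    and near: "\<And>i. i \<in> {1..CARD('n)} \<Longrightarrow> d \<le> cmod (z - complex_of_real (lam i))" and d: "0 < d"
    and far: "\<And>i. i \<in> {1..CARD('n)} - S \<Longrightarrow> s \<le> cmod (z - complex_of_real (lam i))" and s: "0 < s"
  defines "e \<equiv> spectral_norm E"
  shows "spectral_norm (complex_matrix E ** resolvent z A ** complex_matrix E ** resolvent z A)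
    \<le> e * (real (card S) * x / d\<^sup>2) + 2 * (e\<^sup>2 / (d * s)) + e\<^sup>2 / s\<^sup>2"
  unfolding spectral_norm_def
proof (rule onorm_le)
  fix v :: "complex^'n"
  let ?E = "(*v) (complex_matrix E)"
  define g where "g i = 1 / (z - complex_of_real (lam i))" for i
  \<comment> \<open>The entries are cut off outside \<open>S\<close>, as the block estimate
    requires.\<close>
  define P where "P = multiplier (\<lambda>i. if i \<in> S then g i else 0)"
  define Q where "Q = multiplier (\<lambda>i. if i \<in> S then 0 else if i \<in> {1..CARD('n)} then g i else 0)"
  have e0: "0 \<le> e" unfolding e_def by (rule spectral_norm_nonneg)
  have R: "resolvent z A *v w = P w + Q w" for w
  proof -
    have "resolvent z A *v w = multiplier g w"
      unfolding g_def using near d by (intro resolvent_eq_multiplier eig) force+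
    also have "\<dots> = P w + Q w"
      unfolding P_def Q_def by (rule complex_vector_eqI) (simp add: coord_multiplier coord_add)
    finally show ?thesis .
  qed
  have gd: "cmod (g i) \<le> 1 / d" if "i \<in> {1..CARD('n)}" for i
    using near[OF that] d by (simp add: g_def norm_divide frac_le)
  have gs: "cmod (g i) \<le> 1 / s" if "i \<in> {1..CARD('n)} - S" for i
    using far[OF that] s by (simp add: g_def norm_divide frac_le)
  have E: "norm (?E w) \<le> e * norm w" for w
    unfolding e_def by (rule norm_complex_matrix_mult_le)
  have P: "norm (P w) \<le> 1 / d * norm w" for w
    unfolding P_def using gd d by (intro norm_multiplier_le) auto
  have Q: "norm (Q w) \<le> 1 / s * norm w" for w
    unfolding Q_def using gs s by (intro norm_multiplier_le) auto
  \<comment> \<open>Only this term uses the entry bound \<open>x\<close>: the inner \<open>E\<close>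
    costs \<open>card S * x\<close> here, and \<open>e\<close> in the other three terms.\<close>
  have PEP: "norm (P (?E (P v))) \<le> real (card S) * x * (1 / d)\<^sup>2 * norm v"
    unfolding P_def using gd d S x x0 by (intro norm_multiplier_block_le) auto
  have step: "norm (F (?E (G v))) \<le> p * e * q * norm v"
    if "\<And>w. norm (F w) \<le> p * norm w" "\<And>w. norm (G w) \<le> q * norm w" "0 \<le> p"
    for F G :: "complex^'n \<Rightarrow> complex^'n" and p q
  proof -
    have "norm (F (?E (G v))) \<le> p * (e * (q * norm v))"
      using that E[of "G v"] e0
      by (meson mult_left_mono order_trans)
    then show ?thesis by (simp add: mult.assoc)
  qed
  have split: "(complex_matrix E ** resolvent z A ** complex_matrix E ** resolvent z A) *v v
      = ?E (P (?E (P v)) + P (?E (Q v)) + Q (?E (P v)) + Q (?E (Q v)))"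
    by (simp add: matrix_vector_mul_assoc[symmetric] R matrix_vector_right_distrib
        multiplier_add P_def Q_def algebra_simps)
  have "norm ((complex_matrix E ** resolvent z A ** complex_matrix E ** resolvent z A) *v v)
      \<le> e * norm (P (?E (P v)) + P (?E (Q v)) + Q (?E (P v)) + Q (?E (Q v)))"
    unfolding split by (rule E)
  also have "\<dots> \<le> e * (real (card S) * x * (1 / d)\<^sup>2 * norm v + 1 / d * e * (1 / s) * norm v
      + 1 / s * e * (1 / d) * norm v + 1 / s * e * (1 / s) * norm v)"
    using d s by (intro mult_left_mono[OF _ e0] norm_triangle_mono PEP step P Q) auto
  also have "\<dots> = (e * (real (card S) * x / d\<^sup>2) + 2 * (e\<^sup>2 / (d * s)) + e\<^sup>2 / s\<^sup>2) * norm v"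
    using d s by (simp add: field_simps power2_eq_square)
  finally show "norm ((complex_matrix E ** resolvent z A ** complex_matrix E ** resolvent z A) *v v)
      \<le> (e * (real (card S) * x / d\<^sup>2) + 2 * (e\<^sup>2 / (d * s)) + e\<^sup>2 / s\<^sup>2) * norm v" .
qed

end

section \<open>Geometry of the contour\<close>

lemma interval_component_endpoints:
  assumes "(a, b) \<in> interval_components D"
  shows "a \<in> closure D" "a \<notin> D" "b \<in> closure D" "b \<notin> D"
proof -
  have ab: "a < b" and comp: "{a<..<b} \<in> components D"
    using assms by (auto simp: interval_components_def)
  have sub: "{a<..<b} \<subseteq> D" using comp in_components_subset by blast
  have "{a..b} \<subseteq> closure D"
    using closure_mono[OF sub] ab by simp
  then show "a \<in> closure D" "b \<in> closure D" using ab by auto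
  \<comment> \<open>Maximality of the component: if an endpoint belonged to \<open>D\<close>,
    adjoining it would give a strictly larger interval inside \<open>D\<close>.\<close>
  have max: "T \<subseteq> {a<..<b}" if "is_interval T" "T \<subseteq> D" "{a<..<b} \<inter> T \<noteq> {}" for T
    using components_maximal[OF comp] that is_interval_connected by blast
  have ne: "{a<..<b} \<noteq> {}" using ab dense by auto
  show "a \<notin> D"
  proof
    assume a: "a \<in> D"
    have "{a..<b} \<subseteq> D"
    proof
      fix y assume "y \<in> {a..<b}"
      then show "y \<in> D" using a sub by (cases "y = a") auto
    qed
    moreover have "{a<..<b} \<inter> {a..<b} = {a<..<b}" by auto
    ultimately have "{a..<b} \<subseteq> {a<..<b}" using max[of "{a..<b}"] ne is_interval_co by auto
    then show False using ab by auto
  qed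
  show "b \<notin> D"
  proof
    assume b: "b \<in> D"
    have "{a<..b} \<subseteq> D"
    proof
      fix y assume "y \<in> {a<..b}"
      then show "y \<in> D" using b sub by (cases "y = b") auto
    qed
    moreover have "{a<..<b} \<inter> {a<..b} = {a<..<b}" by auto
    ultimately have "{a<..b} \<subseteq> {a<..<b}" using max[of "{a<..b}"] ne is_interval_oc by auto
    then show False using ab by auto
  qed
qed

text \<open>A point of a rectangle's boundary lies on a horizontal side, at height \<open>H\<close>
  or \<open>-H\<close>, or on a vertical side, whose real part is an endpoint of a component of
  \<open>D\<close>.\<close>

lemma rectangle_contour_cases:
  assumes "z \<in> rectangle_contour D H" "0 < H"
  obtains (horizontal) "\<bar>Im z\<bar> = H"
  | (vertical) "Re z \<in> closure D" "Re z \<notin> D"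
proof -
  from assms(1) obtain a b where ab: "(a, b) \<in> interval_components D"
    and z: "z \<in> frontier (cbox (Complex a (- H)) (Complex b H))"
    by (auto simp: rectangle_contour_def)
  have "Re z = a \<or> Re z = b \<or> \<bar>Im z\<bar> = H"
    using z by (auto simp: frontier_cbox in_cbox_complex_iff in_box_complex_iff abs_if)
  then show thesis
    using interval_component_endpoints[OF ab] horizontal vertical by auto
qed

section \<open>Distances from the contour to the spectrum, and the numerical bound on
  \<open>h\<close>\<close>

theorem lemma4p1:
  fixes A E :: "real^'n^'n" and lam :: "nat \<Rightarrow> real" and u :: "nat \<Rightarrow> real^'n"
    and D :: "real set" and K :: real
  defines "n \<equiv> CARD('n)"
  defines "normE \<equiv> spectral_norm E"
    and "\<sigma>1 \<equiv> spectral_norm A"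
    and "x \<equiv> directional_perturbation u E"
    and "\<delta> \<equiv> boundary_gap n lam D"
  defines "r \<equiv> real (num_eigenvalues_within n lam D (K * normE))"
  defines "H \<equiv> 2 * (\<sigma>1 + normE + \<delta>)"
  defines "h \<equiv> r * x * normE / \<delta>\<^sup>2 + 2 * normE / (\<delta> * K) + 1 / K\<^sup>2"
  defines "L \<equiv> 5 * real (num_components D) * ln (9 + 5 * \<sigma>1 / min \<delta> normE)"
  assumes "symmetric_matrix A" and "symmetric_matrix E" and "E \<noteq> 0"
    and "ordered_eigensystem A lam u"
    and "region D" and "\<delta> > 0" and "K > 0"
    and "\<delta> \<ge> 6 * max (sqrt (r * x * normE)) (normE / K)"
    and "D \<subseteq> {lam n - normE .. lam 1 + normE}"
    and "\<And>t. t \<in> endpoints D \<Longrightarrow> \<not> is_eigenvalue (A + E) t"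
    and "K * normE \<le> 2 * \<sigma>1 + \<delta>"
    and "\<delta> \<le> max normE \<sigma>1"
    and "K \<ge> L" and "L > 10"
  shows "(\<forall>z \<in> rectangle_contour D H.
            spectral_norm (complex_matrix E ** resolvent z A ** complex_matrix E ** resolvent z A) \<le> h)
         \<and> h < 1 / 2"
proof -
  interpret orthonormal_family u
    using \<open>ordered_eigensystem A lam u\<close> by unfold_locales (auto simp: ordered_eigensystem_def)
  let ?I = "{1..CARD('n)}"
  have eig: "A *v u i = lam i *s u i" if "i \<in> ?I" for i
    using \<open>ordered_eigensystem A lam u\<close> that by (auto simp: ordered_eigensystem_def)
  have e: "0 < normE" unfolding normE_def by (rule spectral_norm_pos) fact
  have \<sigma>: "0 \<le> \<sigma>1" unfolding \<sigma>1_def by (rule spectral_norm_nonneg)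
  have K10: "10 < K" using assms by linarith
  have x_ge: "\<bar>u i \<bullet> (E *v u j)\<bar> \<le> x" if "i \<in> ?I" "j \<in> ?I" for i j
    unfolding x_def directional_perturbation_def using that by (intro Max_ge) auto
  \<comment> \<open>The index 1 is admissible because \<open>CARD('n)\<close> is positive.\<close>
  have x0: "0 \<le> x" using order_trans[OF abs_ge_zero x_ge[of 1 1]] by (simp add: Suc_le_eq)
  have gap: "\<delta> \<le> infdist (lam i) (frontier D)" if "i \<in> ?I" for i
    unfolding \<delta>_def boundary_gap_def n_def using that by (intro Min_le) auto
  define S where "S = {i \<in> ?I. infdist (lam i) D \<le> K * normE}"
  have r: "r = real (card S)" by (simp add: r_def num_eigenvalues_within_def S_def n_def)
  have openD: "open D" using \<open>region D\<close> by (auto simp: region_def)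
  have bound: "spectral_norm (complex_matrix E ** resolvent z A ** complex_matrix E ** resolvent z A) \<le> h"
    if z: "z \<in> rectangle_contour D H" for z
  proof -
    \<comment> \<open>The eigenvalues are real, so on horizontal sides the height alone gives both
      distance bounds. The second one rests on
      \<open>K * normE \<le> 2 * \<sigma>1 + \<delta>\<close>.\<close>
    have H: "\<delta> \<le> H" "K * normE \<le> H" "0 < H"
      using \<sigma> e \<open>\<delta> > 0\<close> \<open>K * normE \<le> 2 * \<sigma>1 + \<delta>\<close> by (auto simp: H_def)
    have Re_le: "\<bar>Re z - lam i\<bar> \<le> cmod (z - complex_of_real (lam i))" for i
      using abs_Re_le_cmod[of "z - complex_of_real (lam i)"] by simp
    have Im_le: "\<bar>Im z\<bar> \<le> cmod (z - complex_of_real (lam i))" for i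
      using abs_Im_le_cmod[of "z - complex_of_real (lam i)"] by simp
    have dists: "\<delta> \<le> cmod (z - complex_of_real (lam i)) \<and>
        (i \<notin> S \<longrightarrow> K * normE \<le> cmod (z - complex_of_real (lam i)))" if i: "i \<in> ?I" for i
      using z \<open>0 < H\<close>
    proof (cases rule: rectangle_contour_cases)
      case horizontal
      then show ?thesis using H Im_le[of i] by linarith
    next
      case vertical
      \<comment> \<open>Since \<open>D\<close> is open, its frontier is its closure without
        \<open>D\<close>; the definition of \<open>\<delta>\<close> then applies to
        \<open>Re z\<close>.\<close>
      then have "Re z \<in> frontier D"
        using openD by (simp add: frontier_def interior_open)
      then have "infdist (lam i) (frontier D) \<le> \<bar>Re z - lam i\<bar>"
        using infdist_le[of "Re z" "frontier D" "lam i"] by (simp add: dist_real_def abs_minus_commute)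
      \<comment> \<open>A point of the closure has distance 0 from \<open>D\<close>, so the distance
        to \<open>Re z\<close> dominates the distance to \<open>D\<close>, which exceeds
        \<open>K * normE\<close> for \<open>i\<close> outside \<open>S\<close>.\<close>
      moreover have "infdist (lam i) D \<le> \<bar>Re z - lam i\<bar>"
      proof -
        have "infdist (Re z) D = 0"
          using vertical(1) in_closure_iff_infdist_zero[of D "Re z"] by fastforce
        then show ?thesis
          using infdist_triangle[of "lam i" D "Re z"] by (simp add: dist_real_def abs_minus_commute)
      qed
      ultimately show ?thesis
        using gap[OF i] Re_le[of i] i by (auto simp: S_def)
    qed
    have "spectral_norm (complex_matrix E ** resolvent z A ** complex_matrix E ** resolvent z A)
        \<le> spectral_norm E * (real (card S) * x / \<delta>\<^sup>2) + 2 * ((spectral_norm E)\<^sup>2 / (\<delta> * (K * normE)))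
          + (spectral_norm E)\<^sup>2 / (K * normE)\<^sup>2"
      by (rule spectral_norm_resolvent_product_le[where lam = lam])
        (use eig x_ge x0 dists \<open>\<delta> > 0\<close> \<open>K > 0\<close> e in \<open>auto simp: S_def\<close>)
    \<comment> \<open>With \<open>s = K * normE\<close>, the powers of \<open>normE\<close> cancel
      down to those in \<open>h\<close>.\<close>
    also have "\<dots> = h"
      using e \<open>\<delta> > 0\<close> \<open>K > 0\<close> unfolding normE_def[symmetric] h_def r
      by (simp add: field_simps power2_eq_square)
    finally show ?thesis .
  qed
  have "6 * sqrt (r * x * normE) \<le> \<delta>" "6 * (normE / K) \<le> \<delta>"
    using \<open>\<delta> \<ge> 6 * max (sqrt (r * x * normE)) (normE / K)\<close> by auto
  have rx: "0 \<le> r * x * normE" using x0 e by (simp add: r)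
  \<comment> \<open>The three summands of \<open>h\<close> are at most 1/36, 1/3 and 1/100. The
    first two come from the factor 6 in the lower bound on \<open>\<delta>\<close>, the last from
    \<open>K > 10\<close>.\<close>
  have "(6 * sqrt (r * x * normE))\<^sup>2 \<le> \<delta>\<^sup>2"
    using \<open>6 * sqrt (r * x * normE) \<le> \<delta>\<close> rx by (intro power_mono) auto
  then have "r * x * normE / \<delta>\<^sup>2 \<le> 1 / 36"
    using rx \<open>\<delta> > 0\<close> by (simp add: power_mult_distrib field_simps)
  moreover have "2 * normE / (\<delta> * K) \<le> 1 / 3"
    using \<open>6 * (normE / K) \<le> \<delta>\<close> \<open>\<delta> > 0\<close> \<open>K > 0\<close> by (simp add: field_simps)
  moreover have "1 / K\<^sup>2 \<le> 1 / 10\<^sup>2"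
    using K10 by (intro divide_left_mono power_mono) auto
  ultimately have "h < 1 / 2" unfolding h_def by simp
  with bound show ?thesis by blast
qed

end
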